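(* Let $\mu\in\mathcal{K}_T$, and consider the interconnected system $$\dot{\chi}_1=h_1(t,\chi_1,\chi_2,d_1(t)),\qquad \dot{\chi}_2=h_2(t,\chi_1,\chi_2,d_2(t)),$$ where $\chi=[\chi_1^\top,\chi_2^\top]^\top\in\mathbb{R}^{n_1}\times\mathbb{R}^{n_2}$ is the state with initial value $\chi_0=[\chi_1^\top(t_0),\chi_2^\top(t_0)]^\top$, and, for $i=1,2$, $d_i:[t_0,\infty)\to\mathbb{D}_i$ is an external disturbance taking values in a compact set $\mathbb{D}_i\subset\mathbb{R}^{l_i'}$. Suppose that for $i=1,2$ the $\chi_i$-subsystem admits a prescribed-time ISS Lyapunov function $V_i(\chi_i)$ with $d_i$ and $\chi_{3-i}$ as inputs, in the following sense: there are functions $\underline{\alpha}_i,\overline{\alpha}_i,\alpha_i,\gamma_i,\epsilon_i\in\mathcal{K}_\infty$ and finite positive constants $l_i$ such that, for all $\chi_1,\chi_2$ and all $t\in\mathcal{T}_p$, $$\underline{\alpha}_1(\|\chi_1\|)\le V_1(\chi_1)\le\overline{\alpha}_1(\|\chi_1\|),\qquad \dot V_1\le-\alpha_1(\mu)V_1+l_1\alpha_2(\mu)V_2(\chi_2)+\gamma_1(\mu)\epsilon_1(\|d_1\|),$$ $$\underline{\alpha}_2(\|\chi_2\|)\le V_2(\chi_2)\le\overline{\alpha}_2(\|\chi_2\|),\qquad \dot V_2\le-\alpha_2(\mu)V_2+l_2\alpha_1(\mu)V_1(\chi_1)+\gamma_2(\mu)\epsilon_2(\|d_2\|),$$ where $\mu=\mu(t)$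 and $\dot V_i$ denotes the derivative along trajectories of the system. If $$l_1l_2<1\qquad\text{and}\qquad \min\{\alpha_1(s),\alpha_2(s)\}=\mathcal{O}[\gamma_1(s)+\gamma_2(s)]\ \text{ for } s\in\mathbb{R}_+,$$ then $\chi$ is uniformly bounded for $t\in\mathcal{T}_p$, with upper bound $$\|\chi(t)\|\le\tilde{\alpha}(\|\chi_0\|),\qquad t\in\mathcal{T}_p,$$ for some function $\tilde{\alpha}\in\mathcal{K}_\infty^e$.
   Context: $t_0$ is the initial time, $T>0$ the prescribed-time scale, $\mathcal{T}_p=\{t: t_0\le t<T+t_0\}$, and $\mathbb{R}_+$ is the set of non-negative reals. Class $\mathcal{K}_T$: let $\mathbb{R}_p=[b,\infty)$ with $b\ge 0$. A continuously differentiable function $\mu:\mathcal{T}_p\to\mathbb{R}_p$ belongs to $\mathcal{K}_T$ if it is strictly increasing to infinity (as $t\to T+t_0$) and $\dot\mu(t_0)=b'$, $\lim_{t\to T+t_0}\dot\mu(t)=\infty$, $\dot\mu(t)\le\tilde b\,\mu(t)^2$ for all $t\in\mathcal{T}_p$, where $b',\tilde b$ are positive constants (possibly depending on $T$). Class $\mathcal{K}_\infty^e$: functions $\alpha:[0,\infty)\to[b,\infty)$ that are strictly increasing with $\alpha(0)=b>0$ (for some $b>0$). Notation $\mathcal{O}$: for $\mathcal{K}_\infty$ functions $\alpha,\alpha'$, $\alpha(s)=\mathcal{O}[\alpha'(s)]$ means $\sup_{s\in\mathbb{R}_+}[\alpha'(s)/\alpha(s)]<\infty$. Each prescribed-time ISS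 Lyapunov function $V_i:\mathbb{R}^{n_i}\to\mathbb{R}_+$ is continuously differentiable. *)

theory Defs
  imports "HOL-Analysis.Analysis"
begin

definition class_K_inf :: "(real \<Rightarrow> real) \<Rightarrow> bool" where
  "class_K_inf \<alpha> \<longleftrightarrow>
     continuous_on {0..} \<alpha> \<and> strict_mono_on {0..} \<alpha> \<and> \<alpha> 0 = 0 \<and> filterlim \<alpha> at_top at_top"

definition class_K_inf_e :: "(real \<Rightarrow> real) \<Rightarrow> bool" where
  "class_K_inf_e \<alpha> \<longleftrightarrow>
     (\<exists>b>0. \<alpha> ` {0..} \<subseteq> {b..} \<and> strict_mono_on {0..} \<alpha> \<and> \<alpha> 0 = b)"

abbreviation prescribed_times :: "real \<Rightarrow> real \<Rightarrow> real set" where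
  "prescribed_times t0 T \<equiv> {t0..<T + t0}"

(* The derivative at t0 is one-sided, since t0 is the left end point of the domain. *)
definition class_K_T :: "real \<Rightarrow> real \<Rightarrow> (real \<Rightarrow> real) \<Rightarrow> bool" where
  "class_K_T t0 T \<mu> \<longleftrightarrow>
     (\<exists>b\<ge>0. \<mu> ` prescribed_times t0 T \<subseteq> {b..}) \<and>
     strict_mono_on (prescribed_times t0 T) \<mu> \<and>
     filterlim \<mu> at_top (at_left (T + t0)) \<and>
     (\<exists>\<mu>'. (\<forall>t\<in>prescribed_times t0 T.
               (\<mu> has_real_derivative \<mu>' t) (at t within prescribed_times t0 T)) \<and>
           continuous_on (prescribed_times t0 T) \<mu>' \<and>
           (\<exists>b'>0. \<mu>' t0 = b') \<and>
           filterlim \<mu>' at_top (at_left (T + t0)) \<and>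
           (\<exists>bt>0. \<forall>t\<in>prescribed_times t0 T. \<mu>' t \<le> bt * (\<mu> t)\<^sup>2))"

(* alpha = O[alpha'] in the sense of the source: sup of alpha' / alpha is finite, so alpha'
   is dominated by alpha, opposite to the Landau convention.  For class K_infinity functions
   the quotient at s = 0 is 0 / 0 = 0 in HOL and does not affect finiteness. *)
definition order_O :: "(real \<Rightarrow> real) \<Rightarrow> (real \<Rightarrow> real) \<Rightarrow> bool" where
  "order_O \<alpha> \<alpha>' \<longleftrightarrow> bdd_above ((\<lambda>s. \<alpha>' s / \<alpha> s) ` {0..})"

definition continuously_differentiable :: "('a::euclidean_space \<Rightarrow> real) \<Rightarrow> bool" where
  "continuously_differentiable V \<longleftrightarrow>
     (\<exists>V' :: 'a \<Rightarrow> 'a \<Rightarrow>\<^sub>L real.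
        (\<forall>x. (V has_derivative blinfun_apply (V' x)) (at x)) \<and> continuous_on UNIV V')"

(* The derivative of V along trajectories, at a state x with velocity v. *)
definition deriv_along :: "('a::euclidean_space \<Rightarrow> real) \<Rightarrow> 'a \<Rightarrow> 'a \<Rightarrow> real" where
  "deriv_along V x v = frechet_derivative V (at x) v"

(* Solutions on the half-open interval from t0 to t1, via the equivalent integral equation.
   The disturbances need not be continuous, so the differential equation cannot be required at
   every time.  The integral is the Henstock-Kurzweil one: it covers every classical
   solution and every Caratheodory solution (absolutely continuous on compact intervals). *)
definition solves_interconnection ::
  "real \<Rightarrow> real \<Rightarrow>
   (real \<Rightarrow> 'a \<Rightarrow> 'b \<Rightarrow> 'c \<Rightarrow> 'a::euclidean_space) \<Rightarrow>
   (real \<Rightarrow> 'a \<Rightarrow> 'b \<Rightarrow> 'd \<Rightarrow> 'b::euclidean_space) \<Rightarrow>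
   (real \<Rightarrow> 'c) \<Rightarrow> (real \<Rightarrow> 'd) \<Rightarrow> (real \<Rightarrow> 'a) \<Rightarrow> (real \<Rightarrow> 'b) \<Rightarrow> bool" where
  "solves_interconnection t0 t1 h1 h2 d1 d2 x1 x2 \<longleftrightarrow>
     (\<forall>t\<in>{t0..<t1}.
        ((\<lambda>s. h1 s (x1 s) (x2 s) (d1 s)) has_integral (x1 t - x1 t0)) {t0..t} \<and>
        ((\<lambda>s. h2 s (x1 s) (x2 s) (d2 s)) has_integral (x2 t - x2 t0)) {t0..t})"

lemma classical_imp_integral:
  fixes x :: "real \<Rightarrow> 'a::euclidean_space"
  assumes "\<And>t. t \<in> {t0..<t1} \<Longrightarrow> (x has_vector_derivative f t) (at t within {t0..<t1})"
    and "t \<in> {t0..<t1}"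
  shows "(f has_integral (x t - x t0)) {t0..t}"
proof (rule fundamental_theorem_of_calculus)
  show "t0 \<le> t" using assms(2) by simp
  fix s assume "s \<in> {t0..t}"
  then show "(x has_vector_derivative f s) (at s within {t0..t})"
    using assms(2) by (intro has_vector_derivative_within_subset[OF assms(1)]) auto
qed

lemma integral_imp_classical:
  fixes x :: "real \<Rightarrow> 'a::euclidean_space"
  assumes f: "\<And>t. t \<in> {t0..<t1} \<Longrightarrow> (f has_integral (x t - x t0)) {t0..t}"
    and cont: "continuous_on {t0..<t1} f"
    and t: "t \<in> {t0..<t1}"
  shows "(x has_vector_derivative f t) (at t within {t0..<t1})"
proof -
  obtain c where c: "t < c" "c < t1" using t dense[of t t1] by auto
  have cont': "continuous_on {t0..c} f"
    using c by (intro continuous_on_subset[OF cont]) auto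
  have "((\<lambda>u. integral {t0..u} f) has_vector_derivative f t) (at t within {t0..c})"
    using t c by (intro integral_has_vector_derivative[OF cont']) auto
  then have "((\<lambda>u. x t0 + integral {t0..u} f) has_vector_derivative f t) (at t within {t0..c})"
    by (auto intro!: derivative_eq_intros)
  then have "(x has_vector_derivative f t) (at t within {t0..c})"
    by (rule has_vector_derivative_transform[rotated 2])
       (use t c f[THEN integral_unique] in auto)
  moreover have "at t within {t0..c} = at t within {t0..<t1}"
    by (rule at_within_nhd[of _ "{..<c}"]) (use c in auto)
  ultimately show ?thesis by simp
qed

lemma solves_interconnection_classical:
  assumes "\<And>t. t \<in> {t0..<t1} \<Longrightarrow>
      (x1 has_vector_derivative h1 t (x1 t) (x2 t) (d1 t)) (at t within {t0..<t1})"
    and "\<And>t. t \<in> {t0..<t1} \<Longrightarrow>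
      (x2 has_vector_derivative h2 t (x1 t) (x2 t) (d2 t)) (at t within {t0..<t1})"
  shows "solves_interconnection t0 t1 h1 h2 d1 d2 x1 x2"
  unfolding solves_interconnection_def
  by (intro ballI conjI; rule classical_imp_integral; (rule assms)?; assumption)

lemma solves_interconnection_iff_classical:
  assumes "continuous_on {t0..<t1} (\<lambda>t. h1 t (x1 t) (x2 t) (d1 t))"
    and "continuous_on {t0..<t1} (\<lambda>t. h2 t (x1 t) (x2 t) (d2 t))"
  shows "solves_interconnection t0 t1 h1 h2 d1 d2 x1 x2 \<longleftrightarrow>
    (\<forall>t\<in>{t0..<t1}.
      (x1 has_vector_derivative h1 t (x1 t) (x2 t) (d1 t)) (at t within {t0..<t1}) \<and>
      (x2 has_vector_derivative h2 t (x1 t) (x2 t) (d2 t)) (at t within {t0..<t1}))"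
proof
  assume "solves_interconnection t0 t1 h1 h2 d1 d2 x1 x2"
  then show "\<forall>t\<in>{t0..<t1}.
      (x1 has_vector_derivative h1 t (x1 t) (x2 t) (d1 t)) (at t within {t0..<t1}) \<and>
      (x2 has_vector_derivative h2 t (x1 t) (x2 t) (d2 t)) (at t within {t0..<t1})"
    unfolding solves_interconnection_def
    using integral_imp_classical[OF _ assms(1), of x1]
      integral_imp_classical[OF _ assms(2), of x2] by blast
next
  assume "\<forall>t\<in>{t0..<t1}.
      (x1 has_vector_derivative h1 t (x1 t) (x2 t) (d1 t)) (at t within {t0..<t1}) \<and>
      (x2 has_vector_derivative h2 t (x1 t) (x2 t) (d2 t)) (at t within {t0..<t1})"
  then show "solves_interconnection t0 t1 h1 h2 d1 d2 x1 x2"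
    by (intro solves_interconnection_classical) auto
qed

end

theory Submission
  imports Defs
begin

text \<open>
  For \<open>l1 < c < 1 / l2\<close> the function \<open>W = V1 + c * V2\<close> satisfies
  \<open>W' \<le> min (\<alpha>1 \<mu>) (\<alpha>2 \<mu>) * (E * M - k * W)\<close> along trajectories with some
  \<open>k > 0\<close>: the cross terms are absorbed because \<open>l1 * l2 < 1\<close>, the disturbances are
  bounded, and their gains satisfy \<open>\<gamma>1 + \<gamma>2 \<le> M * min \<alpha>1 \<alpha>2\<close>.  So \<open>W\<close>
  cannot grow while it is above \<open>E * M / k\<close>.  As solutions are only given by Henstock-Kurzweil
  integrals, this monotonicity rests on a chain rule for such integrals, which follows from
  Henstock's lemma.
\<close>

hide_const (open) Polynomial.content

section \<open>Chain rule for Henstock-Kurzweil integrals\<close>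

text \<open>Over a tagged division the increments of \<open>V\<close> along \<open>x\<close>
  telescope. On each interval the Riemann term of \<open>V' (x s) (f s)\<close> misses the increment
  of \<open>V\<close> by the linearization error of \<open>V\<close> and by \<open>V' (x s)\<close>
  applied to the Riemann term of \<open>f\<close> minus its integral. Henstock's lemma bounds the
  sum of the norms of these differences, where the definition of the integral bounds only the norm
  of their sum.\<close>

lemma has_integral_chain_rule:
  fixes x f :: "real \<Rightarrow> 'a::euclidean_space" and V :: "'a \<Rightarrow> 'b::real_normed_vector"
  assumes ab: "a \<le> b"
    and x: "\<And>t. t \<in> {a..b} \<Longrightarrow> (f has_integral (x t - x a)) {a..t}"
    and V: "\<And>y. (V has_derivative blinfun_apply (V' y)) (at y)"
    and V': "continuous_on UNIV V'"
  shows "((\<lambda>s. V' (x s) (f s)) has_integral (V (x b) - V (x a))) {a..b}"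
  unfolding has_integral_real
proof (intro allI impI)
  fix e :: real assume "e > 0"
  have intf: "f integrable_on {a..b}"
    using x[of b] ab by auto
  have contx: "continuous_on {a..b} x"
  proof (rule continuous_on_eq)
    show "continuous_on {a..b} (\<lambda>t. x a + integral {a..t} f)"
      by (intro continuous_intros indefinite_integral_continuous_1 intf)
    show "x a + integral {a..t} f = x t" if "t \<in> {a..b}" for t
      using integral_unique[OF x[OF that]] by simp
  qed
  have "compact ((\<lambda>s. V' (x s)) ` {a..b})"
    by (intro compact_continuous_image continuous_on_compose2[OF V' contx]) auto
  then obtain B where "B > 0" and B: "\<And>s. s \<in> {a..b} \<Longrightarrow> norm (V' (x s)) \<le> B"
    using compact_imp_bounded by (force simp: bounded_pos)
  \<comment> \<open>In the final sum the Henstock error carries the factor \<open>B + 1\<close>,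
    with \<open>B\<close> from \<open>V'\<close> and \<open>1\<close> from
    \<open>r s \<le> 1\<close>, and \<open>e2\<close> carries \<open>b - a\<close>; each product is
    at most \<open>e / 2\<close>. The \<open>+ 1\<close> in \<open>e2\<close> covers
    \<open>a = b\<close>.\<close>
  define e1 where "e1 = e / (2 * (B + 1))"
  define e2 where "e2 = e / (2 * (b - a + 1))"
  have e12: "e1 > 0" "e2 > 0" using \<open>e > 0\<close> \<open>B > 0\<close> ab by (auto simp: e1_def e2_def)
  \<comment> \<open>Since \<open>x\<close> need not have bounded variation, the tolerance for \<open>V'\<close> has to depend on the
      tag: its product with \<open>norm (f s)\<close> is at most \<open>e2\<close>.\<close>
  define r where "r s = min 1 (e2 / (norm (f s) + 1))" for s
  have r: "r s > 0" "r s \<le> 1" "r s * norm (f s) \<le> e2" for s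
  proof -
    show "r s > 0" unfolding r_def using e12 by (simp add: add_nonneg_pos)
    show "r s \<le> 1" unfolding r_def by simp
    have "r s * norm (f s) \<le> e2 / (norm (f s) + 1) * (norm (f s) + 1)"
      unfolding r_def using e12 by (intro mult_mono) auto
    then show "r s * norm (f s) \<le> e2"
      using norm_ge_zero[of "f s"] by (auto simp: add_nonneg_eq_0_iff)
  qed
  \<comment> \<open>Mean value inequality: near \<open>s\<close> the curve stays in a ball around
    \<open>x s\<close> on which \<open>V'\<close> differs from \<open>V' (x s)\<close> by less than
    \<open>r s\<close>. The ball is convex, so it contains the segment from \<open>x u\<close> to
    \<open>x v\<close>.\<close>
  have "\<exists>d>0. \<forall>u\<in>{a..b}. \<forall>v\<in>{a..b}. dist u s < d \<longrightarrow> dist v s < d \<longrightarrow>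
          norm (V (x v) - V (x u) - V' (x s) (x v - x u)) \<le> r s * norm (x v - x u)"
    if s: "s \<in> {a..b}" for s
  proof -
    have "isCont V' (x s)"
      using V' by (simp add: continuous_on_eq_continuous_at)
    then obtain q where q: "q > 0" "\<And>y. dist y (x s) < q \<Longrightarrow> dist (V' y) (V' (x s)) < r s"
      using r(1)[of s] unfolding continuous_at_eps_delta by blast
    obtain d where d: "d > 0" "\<And>u. u \<in> {a..b} \<Longrightarrow> dist u s < d \<Longrightarrow> dist (x u) (x s) < q"
      using contx s q(1) unfolding continuous_on_iff by blast
    have "norm (V (x v) - V (x u) - V' (x s) (x v - x u)) \<le> norm (x v - x u) * r s"
      if "u \<in> {a..b}" "v \<in> {a..b}" "dist u s < d" "dist v s < d" for u v
    proof (rule differentiable_bound_linearization[where S="ball (x s) q" 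
          and f'="\<lambda>y. blinfun_apply (V' y)"])
      show "x u + t *\<^sub>R (x v - x u) \<in> ball (x s) q" if "t \<in> {0..1}" for t :: real
      proof -
        have "(1 - t) *\<^sub>R x u + t *\<^sub>R x v \<in> ball (x s) q"
          using that d(2)[of u] d(2)[of v] \<open>u \<in> _\<close> \<open>v \<in> _\<close> \<open>dist u s < d\<close> \<open>dist v s < d\<close>
          by (intro convexD[OF convex_ball]) (auto simp: dist_commute)
        then show ?thesis by (simp add: algebra_simps)
      qed
      show "(V has_derivative blinfun_apply (V' y)) (at y within ball (x s) q)" for y
        by (rule has_derivative_at_withinI[OF V])
      show "onorm (blinfun_apply (V' y) - blinfun_apply (V' (x s))) \<le> r s" 
        if "y \<in> ball (x s) q" for y
        using q(2)[of y] that
        by (simp add: dist_norm norm_blinfun.rep_eq minus_blinfun.rep_eq fun_diff_def norm_minus_commute)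
      show "x s \<in> ball (x s) q" using q(1) by simp
    qed
    with d(1) show ?thesis by (auto simp: mult.commute)
  qed
  then obtain d where d: "\<And>s. s \<in> {a..b} \<Longrightarrow> d s > 0"
    "\<And>s u v. \<lbrakk>s \<in> {a..b}; u \<in> {a..b}; v \<in> {a..b}; dist u s < d s; dist v s < d s\<rbrakk> \<Longrightarrow>
          norm (V (x v) - V (x u) - V' (x s) (x v - x u)) \<le> r s * norm (x v - x u)"
    by metis
  obtain g where g: "gauge g"
    "\<And>p. \<lbrakk>p tagged_partial_division_of {a..b}; g fine p\<rbrakk> \<Longrightarrow>
       (\<Sum>(s,K)\<in>p. norm (content K *\<^sub>R f s - integral K f)) < e1"
    using Henstock_lemma[of f a b e1] intf e12(1) by (auto simp: box_real)
  \<comment> \<open>The radius 1 outside \<open>{a..b}\<close>, where \<open>d\<close> is not known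
    to be positive, only makes \<open>h\<close> a gauge; the tags lie in
    \<open>{a..b}\<close>.\<close>
  define h where "h s = g s \<inter> ball s (if s \<in> {a..b} then d s else 1)" for s
  have "gauge h"
    unfolding h_def using d(1) by (intro gauge_Int g(1)) (auto simp: gauge_def)
  moreover have "norm ((\<Sum>(s,K)\<in>p. content K *\<^sub>R V' (x s) (f s)) - (V (x b) - V (x a))) < e"
    if p: "p tagged_division_of {a..b}" and fine: "h fine p" for p
  proof -
    let ?D = "\<lambda>(s,K). content K *\<^sub>R f s - integral K f"
    have "g fine p" using fine unfolding h_def fine_Int by (rule conjunct1)
    then have hen: "(\<Sum>z\<in>p. norm (?D z)) < e1"
      using g(2)[of p] p by (simp add: tagged_division_of_def case_prod_unfold)
    have step: "norm (content K *\<^sub>R V' (x s) (f s) - (V (x (Sup K)) - V (x (Inf K))))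
        \<le> (B + 1) * norm (?D (s, K)) + e2 * content K" if sK: "(s, K) \<in> p" for s K
    proof -
      have s: "s \<in> K" and K: "K \<subseteq> {a..b}"
        using p sK by (auto simp: tagged_division_of_def tagged_partial_division_of_def)
      obtain u v where uv: "K = {u..v}"
        using tagged_division_ofD(4)[OF p sK] by (auto simp: box_real)
      have "K \<subseteq> h s" using fine sK by (auto simp: fine_def)
      then have near: "dist z s < d s" if "z \<in> K" for z
        using that subsetD[OF K s] by (auto simp: h_def dist_commute)
      have le: "u \<le> v" "u \<in> {a..b}" "v \<in> {a..b}" "s \<in> {a..b}" "Sup K = v" "Inf K = u"
        "content K = v - u"
        using s K uv by auto
      have xv: "x v - x u = integral K f"
      proof -
        have "integral {a..u} f + integral {u..v} f = integral {a..v} f"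
          using le by (intro Henstock_Kurzweil_Integration.integral_combine
             integrable_subinterval_real[OF intf]) auto
        then show ?thesis
          using integral_unique[OF x[OF le(2)]] integral_unique[OF x[OF le(3)]] uv
          by (simp add: algebra_simps)
      qed
      define D where "D = content K *\<^sub>R f s - integral K f"
      have "norm (content K *\<^sub>R V' (x s) (f s) - (V (x v) - V (x u)))
          = norm (V' (x s) D - (V (x v) - V (x u) - V' (x s) (x v - x u)))"
        unfolding D_def xv by (simp add: blinfun.bilinear_simps)
      also have "\<dots> \<le> norm (V' (x s) D) + norm (V (x v) - V (x u) - V' (x s) (x v - x u))"
        by (rule norm_triangle_ineq4)
      also have "norm (V (x v) - V (x u) - V' (x s) (x v - x u)) \<le> r s * norm (x v - x u)"
        using le near[of u] near[of v] uv by (intro d(2)) auto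
      \<comment> \<open>Splitting off the Henstock error leaves
        \<open>content K * norm (f s)\<close>, which the factor \<open>r s\<close> reduces to at
        most \<open>e2 * content K\<close>; this sums to \<open>e2 * (b - a)\<close>.\<close>
      also have "norm (x v - x u) \<le> norm D + content K * norm (f s)"
      proof -
        have "x v - x u = content K *\<^sub>R f s - D" unfolding xv D_def by simp
        then show ?thesis using norm_triangle_ineq4[of "content K *\<^sub>R f s" D] le by simp
      qed
      also have "norm (V' (x s) D) \<le> B * norm D"
        using norm_blinfun[of "V' (x s)" D] B[OF le(4)]
        by (meson mult_right_mono norm_ge_zero order_trans)
      also have "r s * (norm D + content K * norm (f s)) \<le> norm D + e2 * content K"
      proof -
        have "r s * norm D \<le> 1 * norm D" using r[of s] by (intro mult_right_mono) auto
        moreover have "r s * norm (f s) * content K \<le> e2 * content K"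
          using r[of s] by (intro mult_right_mono) auto
        ultimately show ?thesis by (simp add: algebra_simps)
      qed
      finally show ?thesis using r(1)[of s] unfolding le(5,6) D_def by (simp add: algebra_simps)
    qed
    have "(\<Sum>(s,K)\<in>p. content K *\<^sub>R V' (x s) (f s)) - (V (x b) - V (x a))
        = (\<Sum>(s,K)\<in>p. content K *\<^sub>R V' (x s) (f s)) - (\<Sum>(s,K)\<in>p. V (x (Sup K)) - V (x (Inf K)))"
      using additive_tagged_division_1[OF ab p, of "\<lambda>t. V (x t)"] by simp
    also have "\<dots> = (\<Sum>(s,K)\<in>p. content K *\<^sub>R V' (x s) (f s) - (V (x (Sup K)) - V (x (Inf K))))"
      by (simp add: sum_subtractf case_prod_unfold)
    also have "norm \<dots> \<le> (\<Sum>(s,K)\<in>p. (B + 1) * norm (?D (s, K)) + e2 * content K)"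
      using step by (intro sum_norm_le) auto
    also have "\<dots> = (B + 1) * (\<Sum>z\<in>p. norm (?D z)) + e2 * (\<Sum>(s,K)\<in>p. content K)"
      by (simp add: sum.distrib sum_distrib_left case_prod_unfold)
    also have "(\<Sum>(s,K)\<in>p. content K) = b - a"
      using additive_content_tagged_division[of p a b] p ab by (simp add: box_real)
    also have "(B + 1) * (\<Sum>z\<in>p. norm (?D z)) + e2 * (b - a) < (B + 1) * e1 + e2 * (b - a)"
      using hen \<open>B > 0\<close> by simp
    also have "\<dots> \<le> e / 2 + e / 2"
      using \<open>B > 0\<close> \<open>e > 0\<close> ab by (intro add_mono) (auto simp: e1_def e2_def field_simps)
    finally show ?thesis by simp
  qed
  ultimately show "\<exists>\<gamma>. gauge \<gamma> \<and> (\<forall>p. p tagged_division_of {a..b} \<and> \<gamma> fine p \<longrightarrow>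
      norm ((\<Sum>(s,K)\<in>p. content K *\<^sub>R V' (x s) (f s)) - (V (x b) - V (x a))) < e)"
    by (intro exI[of _ h] conjI allI impI) (assumption | erule conjE)+
qed

lemma continuously_differentiable_has_integral:
  fixes x f :: "real \<Rightarrow> 'a::euclidean_space"
  assumes "continuously_differentiable V" and "a \<le> b"
    and "\<And>t. t \<in> {a..b} \<Longrightarrow> (f has_integral (x t - x a)) {a..t}"
  shows "((\<lambda>s. deriv_along V (x s) (f s)) has_integral (V (x b) - V (x a))) {a..b}"
proof -
  obtain V' where V': "\<And>y. (V has_derivative blinfun_apply (V' y)) (at y)" "continuous_on UNIV V'"
    using assms(1) unfolding continuously_differentiable_def by blast
  have "deriv_along V y v = V' y v" for y v
    unfolding deriv_along_def using frechet_derivative_at[OF V'(1)] by simp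
  then show ?thesis
    using has_integral_chain_rule[OF assms(2,3) V'] by simp
qed

section \<open>Comparison argument for indefinite integrals\<close>

text \<open>If \<open>W b\<close> exceeded \<open>M\<close>, there would be a last time
  \<open>s\<close> with \<open>W s \<le> M\<close>, since \<open>W\<close> is continuous as an
  indefinite integral. After \<open>s\<close> the density \<open>g\<close> is nonpositive, so
  integrating it over \<open>{s..b}\<close> gives \<open>W b \<le> W s\<close>. Working with the
  integral avoids derivatives of \<open>W\<close>.\<close>

lemma has_integral_stays_below:
  fixes W g :: "real \<Rightarrow> real"
  assumes W: "\<And>t. t \<in> {a..b} \<Longrightarrow> (g has_integral (W t - W a)) {a..t}"
    and "W a \<le> M"
    and g: "\<And>t. t \<in> {a..b} \<Longrightarrow> M \<le> W t \<Longrightarrow> g t \<le> 0"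
    and "a \<le> b"
  shows "W b \<le> M"
proof (rule ccontr)
  assume *: "\<not> W b \<le> M"
  have intg: "g integrable_on {a..b}" using W[of b] \<open>a \<le> b\<close> by auto
  have contW: "continuous_on {a..b} W"
  proof (rule continuous_on_eq)
    show "continuous_on {a..b} (\<lambda>t. W a + integral {a..t} g)"
      by (intro continuous_intros indefinite_integral_continuous_1 intg)
    show "W a + integral {a..t} g = W t" if "t \<in> {a..b}" for t
      using integral_unique[OF W[OF that]] by simp
  qed
  define S where "S = {a..b} \<inter> W -` {..M}"
  have "closed S"
    unfolding S_def by (intro continuous_closed_preimage contW closed_atMost closed_real_atLeastAtMost)
  moreover have "bounded S"
    by (rule bounded_subset[OF bounded_closed_interval, of _ a b]) (simp add: S_def)
  ultimately have "compact S"
    by (simp add: compact_eq_bounded_closed)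
  moreover have "a \<in> S" using assms by (simp add: S_def)
  ultimately obtain s where s: "s \<in> S" "\<And>t. t \<in> S \<Longrightarrow> t \<le> s"
    using compact_attains_sup[of S] by blast
  have sab: "s \<in> {a..b}" "W s \<le> M" using s(1) by (auto simp: S_def)
  have "integral {a..s} g + integral {s..b} g = integral {a..b} g"
    using sab by (intro Henstock_Kurzweil_Integration.integral_combine intg) auto
  then have "integral {s..b} g = W b - W s"
    using integral_unique[OF W[OF sab(1)]] integral_unique[OF W[of b]] \<open>a \<le> b\<close> by auto
  moreover have "g integrable_on {s..b}"
    using sab by (intro integrable_subinterval_real[OF intg]) auto
  ultimately have "(g has_integral (W b - W s)) {s..b}"
    by (metis integrable_integral)
  \<comment> \<open>At \<open>s\<close> itself only \<open>W s \<le> M\<close> is available, which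
    need not give a sign of \<open>g s\<close>; replacing this one value by 0 leaves the integral
    unchanged.\<close>
  then have "W b - W s \<le> 0"
  proof (rule has_integral_le[OF has_integral_spike_finite[of "{s}", rotated 2]])
    show "((\<lambda>_. 0) has_integral 0) {s..b}" by simp
    show "(if t = s then 0 else g t) \<le> 0" if "t \<in> {s..b}" for t
      using that s(2)[of t] sab g[of t] by (force simp: S_def)
  qed auto
  with * sab show False by simp
qed

section \<open>Comparison functions and the constants they yield\<close>

lemma class_K_inf_nonneg:
  assumes "class_K_inf \<alpha>" and "0 \<le> s"
  shows "0 \<le> \<alpha> s"
  using assms strict_mono_on_leD[of "{0..}" \<alpha> 0 s] by (auto simp: class_K_inf_def)

lemma class_K_inf_mono:
  assumes "class_K_inf \<alpha>" and "0 \<le> s" and "s \<le> t"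
  shows "\<alpha> s \<le> \<alpha> t"
  using assms strict_mono_on_leD[of "{0..}" \<alpha> s t] by (auto simp: class_K_inf_def)

text \<open>The supremum of \<open>{x. 0 \<le> x \<and> \<alpha> x \<le> y}\<close> serves as a
  generalized inverse: the set is bounded because \<open>\<alpha>\<close> tends to infinity, and it
  grows with \<open>y\<close>.\<close>

lemma class_K_inf_upper_inverse:
  assumes "class_K_inf \<alpha>"
  obtains g where "\<And>y. 0 \<le> y \<Longrightarrow> 0 \<le> g y" "mono_on {0..} g"
    "\<And>x y. 0 \<le> x \<Longrightarrow> \<alpha> x \<le> y \<Longrightarrow> x \<le> g y"
proof -
  define A where "A y = {x. 0 \<le> x \<and> \<alpha> x \<le> y}" for y
  have bdd: "bdd_above (A y)" for y
  proof -
    have "eventually (\<lambda>x. y < \<alpha> x) at_top"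
      using assms by (simp add: class_K_inf_def filterlim_at_top_dense)
    then obtain N where "\<And>x. N \<le> x \<Longrightarrow> y < \<alpha> x" by (auto simp: eventually_at_top_linorder)
    then show ?thesis 
      by (intro bdd_aboveI[of _ N]) (auto simp: A_def not_less[symmetric] less_imp_le)
  qed
  have zero: "0 \<in> A y" if "0 \<le> y" for y
    using assms that by (simp add: A_def class_K_inf_def)
  show ?thesis
  proof
    show "0 \<le> Sup (A y)" if "0 \<le> y" for y
      by (rule cSup_upper[OF zero[OF that] bdd])
    show "mono_on {0..} (\<lambda>y. Sup (A y))"
    proof (intro mono_onI cSup_subset_mono bdd)
      fix y z :: real assume "y \<in> {0..}" "y \<le> z"
      then show "A y \<noteq> {}" "A y \<subseteq> A z" using zero[of y] by (auto simp: A_def)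
    qed
    show "x \<le> Sup (A y)" if "0 \<le> x" "\<alpha> x \<le> y" for x y
      using that by (intro cSup_upper bdd) (simp add: A_def)
  qed
qed

text \<open>For \<open>s > 0\<close> the bounded quotient can be multiplied out. At 0 the divisor
  may vanish, so that case rests on the signs of the two values. The maximum with 0 makes the
  constant nonnegative.\<close>

lemma order_O_le:
  assumes "order_O \<alpha> \<alpha>'"
    and "\<And>s. 0 < s \<Longrightarrow> 0 < \<alpha> s" and "\<alpha>' 0 \<le> 0" and "0 \<le> \<alpha> 0"
  obtains M where "0 \<le> M" "\<And>s. 0 \<le> s \<Longrightarrow> \<alpha>' s \<le> M * \<alpha> s"
proof -
  obtain M where M: "\<And>s. 0 \<le> s \<Longrightarrow> \<alpha>' s / \<alpha> s \<le> M"
    using assms(1) unfolding order_O_def bdd_above_def by auto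
  have "\<alpha>' s \<le> max 0 M * \<alpha> s" if "0 \<le> s" for s
  proof (cases "s = 0")
    case True
    have "\<alpha>' 0 \<le> 0" by fact
    also have "0 \<le> max 0 M * \<alpha> 0" using assms(4) by simp
    finally show ?thesis using True by simp
  next
    case False
    then have "0 < \<alpha> s" using that assms(2) by simp
    then have "\<alpha>' s \<le> M * \<alpha> s" using M[OF that] by (simp add: pos_divide_le_eq)
    also have "\<dots> \<le> max 0 M * \<alpha> s" using \<open>0 < \<alpha> s\<close> by (intro mult_right_mono) auto
    finally show ?thesis .
  qed
  then show ?thesis using that[of "max 0 M"] by simp
qed

text \<open>A compact \<open>D\<close> lies in some ball of radius \<open>R\<close>, and
  monotonicity gives the bound \<open>\<epsilon> R\<close>.\<close>

lemma class_K_inf_bounded_disturbance: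
  fixes D :: "'a::euclidean_space set"
  assumes "compact D" and "class_K_inf \<epsilon>"
  obtains E where "0 \<le> E" "\<And>\<delta>. \<delta> \<in> D \<Longrightarrow> \<epsilon> (norm \<delta>) \<le> E"
proof -
  obtain R where "R > 0" "\<And>\<delta>. \<delta> \<in> D \<Longrightarrow> norm \<delta> \<le> R"
    using compact_imp_bounded[OF assms(1)] by (auto simp: bounded_pos)
  then show ?thesis
    using that[of "\<epsilon> R"] class_K_inf_nonneg[OF assms(2), of R] class_K_inf_mono[OF assms(2)]
    by simp
qed

section \<open>Small-gain estimate\<close>

text \<open>The variables stand for values at one instant, and the left side for the bound on the
  derivative of \<open>V1 + c * V2\<close>. Collecting terms, \<open>v1\<close> has the coefficient
  \<open>- a1 * (1 - c * l2)\<close> and \<open>v2\<close> has \<open>- a2 * (c - l1)\<close>; by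
  the conditions on \<open>k\<close> these are at most \<open>- k * min a1 a2\<close> and
  \<open>- k * c * min a1 a2\<close>. The disturbance terms are at most
  \<open>E * M * min a1 a2\<close>, so the hypothesis on \<open>v1 + c * v2\<close> gives the
  sign.\<close>

lemma small_gain_dissipation:
  fixes a1 a2 v1 v2 l1 l2 c g1 g2 e1 e2 E M k :: real
  assumes nonneg: "0 \<le> a1" "0 \<le> a2" "0 \<le> v1" "0 \<le> v2" "0 \<le> g1" "0 \<le> g2" "0 < c" "0 \<le> E"
    and e: "e1 \<le> E" "c * e2 \<le> E"
    and gain: "g1 + g2 \<le> M * min a1 a2"
    and k: "0 \<le> k" "k \<le> 1 - c * l2" "k * c \<le> c - l1"
    and w: "E * M \<le> k * (v1 + c * v2)"
  shows "(- a1 * v1 + l1 * a2 * v2 + g1 * e1) + c * (- a2 * v2 + l2 * a1 * v1 + g2 * e2) \<le> 0"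
proof -
  let ?m = "min a1 a2"
  have "?m * v1 * k \<le> a1 * v1 * (1 - c * l2)"
    using nonneg k by (intro mult_mono) auto
  moreover have "?m * v2 * (k * c) \<le> a2 * v2 * (c - l1)"
    using nonneg k by (intro mult_mono) auto
  moreover have "g1 * e1 + c * (g2 * e2) \<le> E * (M * ?m)"
  proof -
    have "g1 * e1 + g2 * (c * e2) \<le> g1 * E + g2 * E"
      using nonneg e by (intro add_mono mult_left_mono) auto
    also have "\<dots> \<le> E * (M * ?m)"
      using mult_left_mono[OF gain nonneg(8)] by (simp add: algebra_simps)
    finally show ?thesis by (simp add: algebra_simps)
  qed
  moreover have "?m * (E * M) \<le> ?m * (k * (v1 + c * v2))"
    using w nonneg by (intro mult_left_mono) auto
  ultimately show ?thesis by (simp add: algebra_simps)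
qed

section \<open>Uniform boundedness of the interconnection\<close>

text \<open>Choosing \<open>\<alpha>t\<close> before the disturbances and the solution expresses
  uniformity. The end time \<open>t1\<close> may be smaller than \<open>T + t0\<close>, so solutions
  that exist only on a shorter interval are covered as well.\<close>

theorem theorem4p1:
  fixes t0 T l1 l2 :: real
    and \<mu> :: "real \<Rightarrow> real"
    and h1 :: "real \<Rightarrow> real ^ 'n1 \<Rightarrow> real ^ 'n2 \<Rightarrow> real ^ 'p1 \<Rightarrow> real ^ 'n1"
    and h2 :: "real \<Rightarrow> real ^ 'n1 \<Rightarrow> real ^ 'n2 \<Rightarrow> real ^ 'p2 \<Rightarrow> real ^ 'n2"
    and D1 :: "(real ^ 'p1) set" and D2 :: "(real ^ 'p2) set"
    and V1 :: "real ^ 'n1 \<Rightarrow> real" and V2 :: "real ^ 'n2 \<Rightarrow> real"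
    and \<alpha>lo1 \<alpha>lo2 \<alpha>up1 \<alpha>up2 \<alpha>1 \<alpha>2 \<gamma>1 \<gamma>2 \<epsilon>1 \<epsilon>2 :: "real \<Rightarrow> real"
  assumes "T > 0"
    and "class_K_T t0 T \<mu>"
    and "compact D1" and "compact D2"
    and "class_K_inf \<alpha>lo1" and "class_K_inf \<alpha>lo2"
    and "class_K_inf \<alpha>up1" and "class_K_inf \<alpha>up2"
    and "class_K_inf \<alpha>1" and "class_K_inf \<alpha>2"
    and "class_K_inf \<gamma>1" and "class_K_inf \<gamma>2"
    and "class_K_inf \<epsilon>1" and "class_K_inf \<epsilon>2"
    and "l1 > 0" and "l2 > 0"
    and "continuously_differentiable V1" and "continuously_differentiable V2"
    and "\<And>x1. 0 \<le> V1 x1" and "\<And>x2. 0 \<le> V2 x2"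
    and "\<And>x1. \<alpha>lo1 (norm x1) \<le> V1 x1 \<and> V1 x1 \<le> \<alpha>up1 (norm x1)"
    and "\<And>x2. \<alpha>lo2 (norm x2) \<le> V2 x2 \<and> V2 x2 \<le> \<alpha>up2 (norm x2)"
    and "\<And>t x1 x2 \<delta>. t \<in> prescribed_times t0 T \<Longrightarrow> \<delta> \<in> D1 \<Longrightarrow>
           deriv_along V1 x1 (h1 t x1 x2 \<delta>)
             \<le> - \<alpha>1 (\<mu> t) * V1 x1 + l1 * \<alpha>2 (\<mu> t) * V2 x2 + \<gamma>1 (\<mu> t) * \<epsilon>1 (norm \<delta>)"
    and "\<And>t x1 x2 \<delta>. t \<in> prescribed_times t0 T \<Longrightarrow> \<delta> \<in> D2 \<Longrightarrow>
           deriv_along V2 x2 (h2 t x1 x2 \<delta>)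
             \<le> - \<alpha>2 (\<mu> t) * V2 x2 + l2 * \<alpha>1 (\<mu> t) * V1 x1 + \<gamma>2 (\<mu> t) * \<epsilon>2 (norm \<delta>)"
    and "l1 * l2 < 1"
    and "order_O (\<lambda>s. min (\<alpha>1 s) (\<alpha>2 s)) (\<lambda>s. \<gamma>1 s + \<gamma>2 s)"
  shows "\<exists>\<alpha>t. class_K_inf_e \<alpha>t \<and>
           (\<forall>d1 d2 \<chi>1 \<chi>2 t1.
              d1 \<in> {t0..} \<rightarrow> D1 \<longrightarrow> d2 \<in> {t0..} \<rightarrow> D2 \<longrightarrow> t1 \<le> T + t0 \<longrightarrow>
              solves_interconnection t0 t1 h1 h2 d1 d2 \<chi>1 \<chi>2 \<longrightarrow>
              (\<forall>t\<in>{t0..<t1}. norm (\<chi>1 t, \<chi>2 t) \<le> \<alpha>t (norm (\<chi>1 t0, \<chi>2 t0))))"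
proof -
  \<comment> \<open>Midpoint of \<open>l1\<close> and \<open>1 / l2\<close>: strictly between them
    both \<open>c - l1\<close> and \<open>1 - c * l2\<close> are positive.\<close>
  define c where "c = (l1 + 1 / l2) / 2"
  have "l1 < 1 / l2" using \<open>l1 * l2 < 1\<close> \<open>l2 > 0\<close> by (simp add: field_simps)
  then have c: "l1 < c" "c < 1 / l2" "c > 0" using \<open>l1 > 0\<close> by (auto simp: c_def field_simps)
  then have "c * l2 < 1" using \<open>l2 > 0\<close> by (simp add: field_simps)
  \<comment> \<open>The largest rate that both diagonal terms can supply after absorbing the cross
    terms.\<close>
  define k where "k = min (1 - c * l2) ((c - l1) / c)"
  have k: "k > 0" "k \<le> 1 - c * l2" "k * c \<le> c - l1"
    using c \<open>c * l2 < 1\<close> unfolding k_def by (auto simp: min_def field_simps)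
  note K = \<open>class_K_inf \<alpha>1\<close> \<open>class_K_inf \<alpha>2\<close> \<open>class_K_inf \<gamma>1\<close> \<open>class_K_inf \<gamma>2\<close>
    \<open>class_K_inf \<alpha>up1\<close> \<open>class_K_inf \<alpha>up2\<close>
  have pos: "0 < \<alpha> s" if "class_K_inf \<alpha>" "0 < s" for \<alpha> :: "real \<Rightarrow> real" and s
    using that strict_mono_onD[of "{0..}" \<alpha> 0 s] by (auto simp: class_K_inf_def)
  obtain M where M: "0 \<le> M" "\<And>s. 0 \<le> s \<Longrightarrow> \<gamma>1 s + \<gamma>2 s \<le> M * min (\<alpha>1 s) (\<alpha>2 s)"
    using order_O_le[OF \<open>order_O _ _\<close>] pos K(1-4) by (auto simp: class_K_inf_def)
  obtain E1 where E1: "0 \<le> E1" "\<And>\<delta>. \<delta> \<in> D1 \<Longrightarrow> \<epsilon>1 (norm \<delta>) \<le> E1"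
    using class_K_inf_bounded_disturbance[OF \<open>compact D1\<close> \<open>class_K_inf \<epsilon>1\<close>] by blast
  obtain E2 where E2: "0 \<le> E2" "\<And>\<delta>. \<delta> \<in> D2 \<Longrightarrow> \<epsilon>2 (norm \<delta>) \<le> E2"
    using class_K_inf_bounded_disturbance[OF \<open>compact D2\<close> \<open>class_K_inf \<epsilon>2\<close>] by blast
  \<comment> \<open>One bound for both disturbance terms, the second of which carries the weight
    \<open>c\<close>.\<close>
  define E where "E = max E1 (c * E2)"
  have "0 \<le> E" using E1(1) by (simp add: E_def)
  \<comment> \<open>The level of \<open>V1 + c * V2\<close> from which decay outweighs the
    disturbances.\<close>
  define C where "C = E * M / k"
  have "0 \<le> C" using \<open>0 \<le> E\<close> M(1) k(1) by (simp add: C_def)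
  have \<mu>: "0 \<le> \<mu> t" if "t \<in> prescribed_times t0 T" for t
    using \<open>class_K_T t0 T \<mu>\<close> that unfolding class_K_T_def by force

  \<comment> \<open>Boundedness of the weighted Lyapunov function along solutions\<close>
  have bound: "V1 (\<chi>1 t) + c * V2 (\<chi>2 t) \<le> V1 (\<chi>1 t0) + c * V2 (\<chi>2 t0) + C"
    if d: "d1 \<in> {t0..} \<rightarrow> D1" "d2 \<in> {t0..} \<rightarrow> D2" and t1: "t1 \<le> T + t0"
      and sol: "solves_interconnection t0 t1 h1 h2 d1 d2 \<chi>1 \<chi>2" and t: "t \<in> {t0..<t1}"
    for d1 d2 \<chi>1 \<chi>2 t1 t
  proof -
    define f1 where "f1 s = h1 s (\<chi>1 s) (\<chi>2 s) (d1 s)" for s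
    define f2 where "f2 s = h2 s (\<chi>1 s) (\<chi>2 s) (d2 s)" for s
    define W where "W s = V1 (\<chi>1 s) + c * V2 (\<chi>2 s)" for s
    define W' where "W' s = deriv_along V1 (\<chi>1 s) (f1 s) + c * deriv_along V2 (\<chi>2 s) (f2 s)" for s
    have f: "(f1 has_integral (\<chi>1 s - \<chi>1 t0)) {t0..s}" "(f2 has_integral (\<chi>2 s - \<chi>2 t0)) {t0..s}"
      if "s \<in> {t0..t}" for s
      using sol that t unfolding solves_interconnection_def f1_def f2_def by auto
    \<comment> \<open>The threshold \<open>W t0 + C\<close> is at least \<open>W t0\<close> because
      \<open>C\<close> is nonnegative, and at least \<open>C\<close> because \<open>W t0\<close> is;
      hence \<open>W' s \<le> 0\<close> wherever \<open>W s\<close> reaches it.\<close>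
    have "W t \<le> W t0 + C"
    proof (rule has_integral_stays_below[where a=t0 and W=W and g=W'])
      fix s assume s: "s \<in> {t0..t}"
      have "((\<lambda>s. deriv_along V1 (\<chi>1 s) (f1 s)) has_integral (V1 (\<chi>1 s) - V1 (\<chi>1 t0))) {t0..s}"
        using s f(1) by (intro continuously_differentiable_has_integral assms) auto
      moreover have "((\<lambda>s. deriv_along V2 (\<chi>2 s) (f2 s)) has_integral (V2 (\<chi>2 s) - V2 (\<chi>2 t0))) {t0..s}"
        using s f(2) by (intro continuously_differentiable_has_integral assms) auto
      ultimately have "(W' has_integral (V1 (\<chi>1 s) - V1 (\<chi>1 t0) + c * (V2 (\<chi>2 s) - V2 (\<chi>2 t0)))) {t0..s}"
        unfolding W'_def by (intro has_integral_add has_integral_mult_right)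
      then show "(W' has_integral (W s - W t0)) {t0..s}"
        by (simp add: W_def algebra_simps)
    next
      fix s assume s: "s \<in> {t0..t}" and "W t0 + C \<le> W s"
      have sT: "s \<in> prescribed_times t0 T" using s t t1 by auto
      have ds: "d1 s \<in> D1" "d2 s \<in> D2" using d s by auto
      have "0 \<le> W t0" unfolding W_def using assms(19,20) c(3) by simp
      then have "C \<le> W s" using \<open>W t0 + C \<le> W s\<close> by simp
      then have w: "E * M \<le> k * (V1 (\<chi>1 s) + c * V2 (\<chi>2 s))"
        using k(1) by (simp add: C_def W_def field_simps)
      have "W' s \<le> (- \<alpha>1 (\<mu> s) * V1 (\<chi>1 s) + l1 * \<alpha>2 (\<mu> s) * V2 (\<chi>2 s) + \<gamma>1 (\<mu> s) * \<epsilon>1 (norm (d1 s)))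
          + c * (- \<alpha>2 (\<mu> s) * V2 (\<chi>2 s) + l2 * \<alpha>1 (\<mu> s) * V1 (\<chi>1 s) + \<gamma>2 (\<mu> s) * \<epsilon>2 (norm (d2 s)))"
        unfolding W'_def f1_def f2_def using c(3)
        by (intro add_mono mult_left_mono assms(23)[OF sT ds(1)] assms(24)[OF sT ds(2)]) auto
      also have "\<dots> \<le> 0"
      proof (rule small_gain_dissipation[OF _ _ _ _ _ _ c(3) \<open>0 \<le> E\<close> _ _ M(2)[OF \<mu>[OF sT]] _ k(2,3) w])
        show "\<epsilon>1 (norm (d1 s)) \<le> E" using E1(2)[OF ds(1)] by (simp add: E_def)
        show "c * \<epsilon>2 (norm (d2 s)) \<le> E"
          using mult_left_mono[OF E2(2)[OF ds(2)], of c] c(3) unfolding E_def by linarith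
      qed (use assms(19,20) k(1) class_K_inf_nonneg K \<mu>[OF sT] in auto)
      finally show "W' s \<le> 0" .
    qed (use \<open>0 \<le> C\<close> t in auto)
    then show ?thesis by (simp add: W_def)
  qed

  \<comment> \<open>From the Lyapunov bound to a bound on the state\<close>
  obtain g1 where g1: "\<And>y. 0 \<le> y \<Longrightarrow> 0 \<le> g1 y" "mono_on {0..} g1"
    "\<And>x y. 0 \<le> x \<Longrightarrow> \<alpha>lo1 x \<le> y \<Longrightarrow> x \<le> g1 y"
    using class_K_inf_upper_inverse[OF \<open>class_K_inf \<alpha>lo1\<close>] by blast
  obtain g2 where g2: "\<And>y. 0 \<le> y \<Longrightarrow> 0 \<le> g2 y" "mono_on {0..} g2"
    "\<And>x y. 0 \<le> x \<Longrightarrow> \<alpha>lo2 x \<le> y \<Longrightarrow> x \<le> g2 y"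
    using class_K_inf_upper_inverse[OF \<open>class_K_inf \<alpha>lo2\<close>] by blast
  \<comment> \<open>Bound on \<open>V1 + c * V2\<close> along solutions with initial norm
    \<open>r\<close>: its initial value is at most the first two summands. Both Lyapunov functions
    are nonnegative, so \<open>B r\<close> also bounds \<open>V1\<close> and \<open>B r / c\<close>
    bounds \<open>V2\<close>.\<close>
  define B where "B r = \<alpha>up1 r + c * \<alpha>up2 r + C" for r
  have B0: "0 \<le> B r" if "0 \<le> r" for r
    unfolding B_def using that c(3) \<open>0 \<le> C\<close> class_K_inf_nonneg K by simp
  have B_mono: "B r \<le> B s" if "0 \<le> r" "r \<le> s" for r s
    unfolding B_def using that c(3) class_K_inf_mono[OF K(5)] class_K_inf_mono[OF K(6)]
    by (intro add_mono mult_left_mono) auto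
  \<comment> \<open>The summand \<open>1 + r\<close> makes the bound strictly increasing and positive at 0.\<close>
  define \<beta> where "\<beta> r = g1 (B r) + g2 (B r / c) + (1 + r)" for r
  have g1B: "g1 (B r) \<le> g1 (B s)" if "0 \<le> r" "r \<le> s" for r s
    using that B0 B_mono by (intro mono_onD[OF g1(2)]) auto
  have g2B: "g2 (B r / c) \<le> g2 (B s / c)" if "0 \<le> r" "r \<le> s" for r s
    using that B0 B_mono c(3) by (intro mono_onD[OF g2(2)] divide_right_mono) auto
  have smono: "strict_mono_on {0..} \<beta>"
  proof (rule strict_mono_onI)
    fix r s :: real assume "r \<in> {0..}" "r < s"
    then show "\<beta> r < \<beta> s" using g1B[of r s] g2B[of r s] unfolding \<beta>_def by simp
  qed
  have "class_K_inf_e \<beta>"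
    unfolding class_K_inf_e_def
  proof (intro exI[of _ "\<beta> 0"] conjI smono)
    show "0 < \<beta> 0"
      using g1(1)[OF B0[of 0]] g2(1)[of "B 0 / c"] B0[of 0] c(3) by (simp add: \<beta>_def)
    show "\<beta> ` {0..} \<subseteq> {\<beta> 0..}"
      using strict_mono_on_leD[OF smono, of 0] by auto
  qed simp
  moreover have "norm (\<chi>1 t, \<chi>2 t) \<le> \<beta> (norm (\<chi>1 t0, \<chi>2 t0))"
    if *: "d1 \<in> {t0..} \<rightarrow> D1" "d2 \<in> {t0..} \<rightarrow> D2" "t1 \<le> T + t0"
      "solves_interconnection t0 t1 h1 h2 d1 d2 \<chi>1 \<chi>2" "t \<in> {t0..<t1}"
    for d1 d2 \<chi>1 \<chi>2 t1 t
  proof -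
    let ?r = "norm (\<chi>1 t0, \<chi>2 t0)"
    have r: "norm (\<chi>1 t0) \<le> ?r" "norm (\<chi>2 t0) \<le> ?r"
      using norm_fst_le[of "\<chi>1 t0" "\<chi>2 t0"] norm_snd_le[of "\<chi>2 t0" "\<chi>1 t0"] by simp_all
    have "V1 (\<chi>1 t0) \<le> \<alpha>up1 ?r"
      using assms(21) class_K_inf_mono[OF K(5) norm_ge_zero r(1)] order_trans by blast
    moreover have "V2 (\<chi>2 t0) \<le> \<alpha>up2 ?r"
      using assms(22) class_K_inf_mono[OF K(6) norm_ge_zero r(2)] order_trans by blast
    then have "c * V2 (\<chi>2 t0) \<le> c * \<alpha>up2 ?r" using c(3) by simp
    ultimately have WB: "V1 (\<chi>1 t) + c * V2 (\<chi>2 t) \<le> B ?r"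
      using bound[OF *] by (simp add: B_def)
    have "norm (\<chi>1 t) \<le> g1 (B ?r)"
    proof (rule g1(3))
      have "0 \<le> c * V2 (\<chi>2 t)" using c(3) assms(20) by simp
      then show "\<alpha>lo1 (norm (\<chi>1 t)) \<le> B ?r" using WB assms(21)[of "\<chi>1 t"] by linarith
    qed simp
    moreover have "norm (\<chi>2 t) \<le> g2 (B ?r / c)"
    proof (rule g2(3))
      have "V2 (\<chi>2 t) \<le> B ?r / c"
        using WB assms(19)[of "\<chi>1 t"] c(3) by (simp add: pos_le_divide_eq mult.commute)
      then show "\<alpha>lo2 (norm (\<chi>2 t)) \<le> B ?r / c" using assms(22)[of "\<chi>2 t"] by linarith
    qed simp
    ultimately show ?thesis
      using norm_Pair_le[of "\<chi>1 t" "\<chi>2 t"] norm_ge_zero[of "(\<chi>1 t0, \<chi>2 t0)"]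
      unfolding \<beta>_def by linarith
  qed
  ultimately show ?thesis by blast
qed

end
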